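(* Let $G$ and $H$ be connected graphs, each with at least two vertices. Then $\mu(G \odot H) = |V(G)|\,|V(H)|$.
   Context: All graphs are finite, simple, undirected and connected. For a graph $G$ and $X \subseteq V(G)$, two vertices $u,v$ are $X$-visible if there exists a shortest $(u,v)$-path $P$ in $G$ with $V(P)\cap X \subseteq \{u,v\}$. A set $X\subseteq V(G)$ is a mutual-visibility set of $G$ if every two vertices of $X$ are $X$-visible; $\mu(G)$ denotes the maximum cardinality of a mutual-visibility set of $G$. The corona $G\odot H$ is obtained from one copy of $G$ and $|V(G)|$ copies of $H$, the copy associated with $v\in V(G)$ being denoted $H_v$, by joining each $v \in V(G)$ to every vertex of $H_v$. *)

theory Defs
  imports "Graph_Theory.Graph_Theory"
begin

text \<open>
  A finite simple undirected graph is a \<open>pair_graph\<close>: a finite, loop-free digraph with a symmetric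
  set of pairs as arcs, so that an edge \<open>uv\<close> is the pair of arcs \<open>(u, v)\<close> and \<open>(v, u)\<close>. A path is
  an \<open>apath\<close>, the list of its arcs, and its length as a path is the length of that list.
\<close>

definition shortest_path :: "'a pair_pre_digraph \<Rightarrow> 'a \<Rightarrow> ('a \<times> 'a) awalk \<Rightarrow> 'a \<Rightarrow> bool" where
  "shortest_path G u p v \<longleftrightarrow>
     pre_digraph.apath (with_proj G) u p v \<and>
     (\<forall>q. pre_digraph.apath (with_proj G) u q v \<longrightarrow> length p \<le> length q)"

definition visible :: "'a pair_pre_digraph \<Rightarrow> 'a set \<Rightarrow> 'a \<Rightarrow> 'a \<Rightarrow> bool" where
  "visible G X u v \<longleftrightarrow> (\<exists>p. shortest_path G u p v \<and> set (pawalk_verts u p) \<inter> X \<subseteq> {u, v})"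

definition mutual_visibility_set :: "'a pair_pre_digraph \<Rightarrow> 'a set \<Rightarrow> bool" where
  "mutual_visibility_set G X \<longleftrightarrow>
     X \<subseteq> pverts G \<and> (\<forall>u \<in> X. \<forall>v \<in> X. u \<noteq> v \<longrightarrow> visible G X u v)"

definition mutual_visibility_number :: "'a pair_pre_digraph \<Rightarrow> nat" where
  "mutual_visibility_number G = Max (card ` {X. mutual_visibility_set G X})"

text \<open>The maximum is taken over a finite nonempty set, hence it is attained.\<close>

lemma finite_mutual_visibility_sets:
  assumes "pair_graph G"
  shows "finite {X. mutual_visibility_set G X}"
proof -
  interpret pair_graph G by (rule assms)
  have "{X. mutual_visibility_set G X} \<subseteq> Pow (pverts G)"
    by (auto simp: mutual_visibility_set_def)
  then show ?thesis
    using pair_finite_verts by (meson finite_Pow_iff finite_subset)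
qed

lemma mutual_visibility_set_empty: "mutual_visibility_set G {}"
  by (simp add: mutual_visibility_set_def)

text \<open>In the corona, \<open>Inl v\<close> is the vertex \<open>v\<close> of \<open>G\<close>, and \<open>Inr (v, x)\<close> is the vertex \<open>x\<close> of the
  copy \<open>H\<^sub>v\<close>.\<close>

definition corona ::
  "'a pair_pre_digraph \<Rightarrow> 'b pair_pre_digraph \<Rightarrow> ('a + 'a \<times> 'b) pair_pre_digraph" where
  "corona G H =
     \<lparr> pverts = Inl ` pverts G \<union> Inr ` (pverts G \<times> pverts H),
       parcs = {(Inl u, Inl v) | u v. (u, v) \<in> parcs G}
             \<union> {(Inr (v, x), Inr (v, y)) | v x y. v \<in> pverts G \<and> (x, y) \<in> parcs H}
             \<union> {(Inl v, Inr (v, x)) | v x. v \<in> pverts G \<and> x \<in> pverts H}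
             \<union> {(Inr (v, x), Inl v) | v x. v \<in> pverts G \<and> x \<in> pverts H} \<rparr>"

lemma pair_graph_corona:
  assumes "pair_graph G" and "pair_graph H"
  shows "pair_graph (corona G H)"
proof -
  interpret G: pair_graph G by (rule assms(1))
  interpret H: pair_graph H by (rule assms(2))
  have wf: "parcs (corona G H) \<subseteq> pverts (corona G H) \<times> pverts (corona G H)"
    by (auto simp: corona_def dest: G.wellformed' H.wellformed')
  have fin: "finite (pverts (corona G H))"
    by (simp add: corona_def G.pair_finite_verts H.pair_finite_verts)
  have fin_arcs: "finite (parcs (corona G H))"
    using finite_subset[OF wf] fin by simp
  have sym: "symmetric (with_proj (corona G H))"
    using G.pair_sym_arcs H.pair_sym_arcs
    by (auto simp: symmetric_def corona_def sym_def)
  have loop: "fst e \<noteq> snd e" if "e \<in> parcs (corona G H)" for e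
    using that by (auto simp: corona_def dest: G.pair_no_loops H.pair_no_loops)
  show ?thesis
    using wf fin fin_arcs sym loop by unfold_locales auto
qed

end

theory Submission
  imports Defs
begin

text \<open>
  The copies of \<open>H\<close> together form a mutual-visibility set: two vertices of one copy are adjacent or
  have the root of the copy as a common neighbour, and a shortest path between two copies consists
  of a shortest path of \<open>G\<close> between their roots and one further edge at either end. Conversely, the
  root \<open>v\<close> separates \<open>H\<^sub>v\<close> from the rest of the corona. Hence a mutual-visibility set that contains
  \<open>v\<close> and a vertex of \<open>H\<^sub>v\<close> lies in \<open>{v} \<union> V(H\<^sub>v)\<close>, and has at most \<open>|V(H)| + 1 \<le> |V(G)| |V(H)|\<close>
  elements. Any other one maps injectively into \<open>V(G) \<times> V(H)\<close>, each root \<open>v\<close> in it being sent to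
  a fixed vertex of \<open>H\<^sub>v\<close>.
\<close>

section \<open>Walks and shortest paths in general graphs\<close>

text \<open>Under unit arc costs the cost of a walk is its length, and removing cycles of
  nonnegative cost does not raise it. This extends minimality among paths to all walks.\<close>

lemma (in wf_digraph) apath_of_awalk_length_le:
  assumes "awalk u p v"
  obtains q where "apath u q v" "length q \<le> length p"
proof
  show "apath u (awalk_to_apath p) v"
    using assms by (rule apath_awalk_to_apath)
  have "awalk_cost (\<lambda>_. 1) q = real (length q)" for q :: "'b awalk"
    by (induct q) auto
  then show "length (awalk_to_apath p) \<le> length p"
    using awalk_to_path_no_neg_cyc_cost[OF assms, of "\<lambda>_. 1"] by simp
qed

lemma (in pair_pseudo_graph) shortest_path_exists:
  assumes "Digraph_Component.connected (with_proj G)" "u \<in> pverts G" "v \<in> pverts G"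
  obtains p where "shortest_path G u p v"
proof -
  \<comment> \<open>\<open>connected\<close> speaks of the symmetric closure; as the arcs are
    already symmetric, reachability is the same in the graph itself.\<close>
  have "u \<rightarrow>\<^sup>*\<^bsub>with_proj G\<^esub> v"
    using assms by (auto simp: connected_def strongly_connected_def reachable_mk_symmetric_eq[OF pair_sym_arcs])
  then have "\<exists>p. apath u p v"
    by (simp add: reachable_apath)
  then obtain p where "apath u p v" "\<forall>q. apath u q v \<longrightarrow> length p \<le> length q"
    using ex_has_least_nat[of "\<lambda>p. apath u p v" _ length] by blast
  then show thesis
    using that by (auto simp: shortest_path_def)
qed

section \<open>Walks of the corona against walks of \<open>G\<close>\<close>

fun corona_base :: "'a + 'a \<times> 'b \<Rightarrow> 'a" where
  "corona_base (Inl v) = v"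
| "corona_base (Inr (v, x)) = v"

locale corona_graphs = G: pair_graph G + H: pair_graph H
  for G :: "'a pair_pre_digraph" and H :: "'b pair_pre_digraph"

sublocale corona_graphs \<subseteq> C: pair_graph "corona G H"
  by (rule pair_graph_corona) unfold_locales

context corona_graphs
begin

lemma verts_corona: "pverts (corona G H) = Inl ` pverts G \<union> Inr ` (pverts G \<times> pverts H)"
  by (simp add: corona_def)

lemma arcs_corona_cases:
  assumes "e \<in> parcs (corona G H)"
  obtains (root) u v where "e = (Inl u, Inl v)" "(u, v) \<in> parcs G"
  | (copy) v x y where "e = (Inr (v, x), Inr (v, y))" "v \<in> pverts G" "(x, y) \<in> parcs H"
  | (up) v x where "e = (Inl v, Inr (v, x))" "v \<in> pverts G" "x \<in> pverts H"
  | (down) v x where "e = (Inr (v, x), Inl v)" "v \<in> pverts G" "x \<in> pverts H"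
  using assms by (auto simp: corona_def)

lemma arcs_corona_iff [simp]:
  "(Inl u, Inl v) \<in> parcs (corona G H) \<longleftrightarrow> (u, v) \<in> parcs G"
  "(Inl u, Inr (v, x)) \<in> parcs (corona G H) \<longleftrightarrow> u = v \<and> v \<in> pverts G \<and> x \<in> pverts H"
  "(Inr (v, x), Inl u) \<in> parcs (corona G H) \<longleftrightarrow> u = v \<and> v \<in> pverts G \<and> x \<in> pverts H"
  "(Inr (v, x), Inr (w, y)) \<in> parcs (corona G H) \<longleftrightarrow> v = w \<and> v \<in> pverts G \<and> (x, y) \<in> parcs H"
  by (auto simp: corona_def)

text \<open>
  Contracting the copies of \<open>H\<close> turns a walk of the corona into a walk of \<open>G\<close> and loses the edges
  that leave or enter a copy. The second disjunct covers the walks that may stay inside one copy.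
\<close>

lemma awalk_corona_contract:
  assumes "C.awalk u p v"
  shows "(\<exists>q. G.awalk (corona_base u) q (corona_base v)
            \<and> length q + of_bool (\<not> isl u) + of_bool (\<not> isl v) \<le> length p)
       \<or> (\<not> isl u \<and> \<not> isl v \<and> corona_base u = corona_base v)"
  using assms
proof (induct p arbitrary: u)
  case Nil
  then show ?case
    by (cases v) (auto simp: C.awalk_simps verts_corona G.awalk_simps intro!: exI[of _ "[]"])
next
  case (Cons e es)
  then have e: "e \<in> parcs (corona G H)" "u = fst e" and "C.awalk (snd e) es v"
    by (auto simp: C.awalk_simps)
  note IH = Cons.hyps[OF this(3)]
  from e(1) show ?case
  proof (cases rule: arcs_corona_cases)
    case (root a b)
    then obtain q where "G.awalk b q (corona_base v)" "length q + of_bool (\<not> isl v) \<le> length es"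
      using IH by auto
    then have "G.awalk a ((a, b) # q) (corona_base v)"
      "length ((a, b) # q) + of_bool (\<not> isl v) \<le> length (e # es)"
      using root by (auto simp: G.awalk_simps)
    then show ?thesis
      using root e(2) by auto
  next
    case (copy a x y)
    then show ?thesis
      using IH e(2) by force
  next
    case (up a x)
    \<comment> \<open>If the walk ends in the copy it has just entered, the induction hypothesis may
      give only its second disjunct. The empty walk of \<open>G\<close> then works: the arc into the
      copy pays for the end \<open>v\<close>.\<close>
    show ?thesis
    proof (cases "\<not> isl v \<and> corona_base v = a")
      case True
      then show ?thesis
        using up e(2) by (auto simp: G.awalk_simps intro!: exI[of _ "[]"])
    next
      case False
      then show ?thesis
        using IH up e(2) by force
    qed
  next
    case (down a x)
    then show ?thesis
      using IH e(2) by force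
  qed
qed

text \<open>Every arc from a vertex of a copy stays in the copy or ends at its root; the induction
  follows the walk up to its first arc of the second kind.\<close>

lemma awalk_leaving_copy_meets_root:
  assumes "C.awalk (Inr (v, x)) p z" "isl z \<or> corona_base z \<noteq> v"
  shows "Inl v \<in> set (pawalk_verts (Inr (v, x)) p)"
  using assms(1)
proof (induct p arbitrary: x)
  case Nil
  then show ?case
    using assms(2) by (auto simp: C.awalk_simps)
next
  case (Cons e es)
  then have e: "e \<in> parcs (corona G H)" "fst e = Inr (v, x)" and walk: "C.awalk (snd e) es z"
    by (auto simp: C.awalk_simps)
  from e(1) show ?case
  proof (cases rule: arcs_corona_cases)
    case (copy a y y')
    then show ?thesis
      using Cons.hyps e walk by auto
  next
    case (down a y)
    then show ?thesis
      using e walk C.hd_in_awalk_verts(1)[OF walk] by auto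
  qed (use e in auto)
qed

lemma awalk_corona_lift:
  assumes "G.awalk u p v"
  shows "C.awalk (Inl u) (map (map_prod Inl Inl) p) (Inl v)"
  using assms
  by (induct p arbitrary: u) (auto simp: G.awalk_simps C.awalk_simps verts_corona)

lemma pawalk_verts_lift:
  "pawalk_verts (Inl u) (map (map_prod Inl Inl) p) = map Inl (pawalk_verts u p)"
  by (induct p arbitrary: u) auto

section \<open>Lower bound: visibility between vertices of the copies\<close>

text \<open>The root gives a detour of length 2 whose inner vertex lies in no copy. Blocking all of
  \<open>range Inr\<close> forces inner vertices to be roots and covers every smaller set.\<close>

lemma visible_same_copy:
  assumes "v \<in> pverts G" "x \<in> pverts H" "y \<in> pverts H" "x \<noteq> y"
  shows "visible (corona G H) (range Inr) (Inr (v, x)) (Inr (v, y))"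
proof (cases "(x, y) \<in> parcs H")
  case True
  let ?p = "[(Inr (v, x), Inr (v, y))]"
  have "C.apath (Inr (v, x)) ?p (Inr (v, y))"
    using assms True by (auto simp: C.apath_simps verts_corona)
  moreover have "length ?p \<le> length q" if "C.apath (Inr (v, x)) q (Inr (v, y))" for q
    using that assms(4) by (cases q) (auto simp: C.apath_simps)
  ultimately show ?thesis
    unfolding visible_def shortest_path_def by (intro exI[of _ ?p]) auto
next
  case False
  let ?p = "[(Inr (v, x), Inl v), (Inl v, Inr (v, y))]"
  have "C.apath (Inr (v, x)) ?p (Inr (v, y))"
    using assms by (auto simp: C.apath_simps verts_corona)
  \<comment> \<open>The empty path is ruled out by \<open>x \<noteq> y\<close>, a single arc by
    nonadjacency.\<close>
  moreover have "length ?p \<le> length q" if "C.apath (Inr (v, x)) q (Inr (v, y))" for q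
    using that assms(4) False by (cases q; cases "tl q") (auto simp: C.apath_simps)
  ultimately show ?thesis
    unfolding visible_def shortest_path_def by (intro exI[of _ ?p]) auto
qed

lemma visible_distinct_copies:
  assumes "Digraph_Component.connected (with_proj G)"
    and "v \<in> pverts G" "w \<in> pverts G" "v \<noteq> w" "x \<in> pverts H" "y \<in> pverts H"
  shows "visible (corona G H) (range Inr) (Inr (v, x)) (Inr (w, y))"
proof -
  obtain p where p: "shortest_path G v p w"
    using G.shortest_path_exists assms(1-3) .
  let ?p = "map (map_prod Inl Inl) p" and ?e = "(Inl w, Inr (w, y))"
  let ?q = "(Inr (v, x), Inl v) # ?p @ [?e]"
  have walk: "C.awalk (Inl v) ?p (Inl w)"
    using p by (auto simp: shortest_path_def G.apath_def intro: awalk_corona_lift)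
  have arc: "C.awalk (Inl w) [?e] (Inr (w, y))"
    using assms by (auto simp: C.awalk_simps verts_corona)
  have "pawalk_verts (Inl v) (?p @ [?e]) = map Inl (pawalk_verts v p) @ [Inr (w, y)]"
    using C.awalk_verts_append[OF C.awalk_appendI[OF walk arc]] C.awlast_of_awalk[OF walk]
    by (auto simp: pawalk_verts_lift)
  then have verts: "pawalk_verts (Inr (v, x)) ?q
      = Inr (v, x) # map Inl (pawalk_verts v p) @ [Inr (w, y)]"
    by simp
  have "C.awalk (Inr (v, x)) ?q (Inr (w, y))"
    using C.awalk_appendI[OF walk arc] assms
    by (simp add: C.awalk_Cons_iff del: C.awalk_append_iff)
  moreover have "distinct (pawalk_verts (Inr (v, x)) ?q)"
    using p assms(4) unfolding verts
    by (auto simp: shortest_path_def G.apath_def distinct_map)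
  ultimately have path: "C.apath (Inr (v, x)) ?q (Inr (w, y))"
    by (simp only: C.apath_def)
  \<comment> \<open>Contraction of \<open>r\<close> saves one arc at either end; reducing the
    resulting walk of \<open>G\<close> to a path makes it comparable with \<open>p\<close>.\<close>
  have "length ?q \<le> length r" if r: "C.apath (Inr (v, x)) r (Inr (w, y))" for r
  proof -
    obtain r' where "G.awalk v r' w" "length r' + 2 \<le> length r"
      using awalk_corona_contract[OF C.awalkI_apath[OF r]] assms(4) by auto
    moreover obtain r'' where "G.apath v r'' w" "length r'' \<le> length r'"
      using G.apath_of_awalk_length_le \<open>G.awalk v r' w\<close> .
    ultimately show ?thesis
      using p by (force simp: shortest_path_def)
  qed
  with path have "shortest_path (corona G H) (Inr (v, x)) ?q (Inr (w, y))"
    by (simp add: shortest_path_def)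
  moreover have "set (pawalk_verts (Inr (v, x)) ?q) \<inter> range Inr \<subseteq> {Inr (v, x), Inr (w, y)}"
    unfolding verts by auto
  ultimately show ?thesis
    unfolding visible_def by blast
qed

lemma mutual_visibility_set_copies:
  assumes "Digraph_Component.connected (with_proj G)"
  shows "mutual_visibility_set (corona G H) (Inr ` (pverts G \<times> pverts H))"
proof -
  have "visible (corona G H) (Inr ` (pverts G \<times> pverts H)) (Inr (v, x)) (Inr (w, y))"
    if "v \<in> pverts G" "w \<in> pverts G" "x \<in> pverts H" "y \<in> pverts H" "(v, x) \<noteq> (w, y)"
    for v w x y
  proof -
    have "visible (corona G H) (range Inr) (Inr (v, x)) (Inr (w, y))"
      using that visible_same_copy visible_distinct_copies[OF assms] by (cases "v = w") auto
    \<comment> \<open>Visibility is antitone in the blocking set.\<close>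
    then show ?thesis
      unfolding visible_def by blast
  qed
  then show ?thesis
    by (auto simp: mutual_visibility_set_def verts_corona)
qed

section \<open>Upper bound\<close>

text \<open>For any other \<open>z\<close> in \<open>X\<close>, every path from
  \<open>Inr (v, x)\<close> to \<open>z\<close> would have \<open>Inl v\<close> as an inner vertex
  in \<open>X\<close>.\<close>

lemma mutual_visibility_set_root_and_copy:
  assumes "mutual_visibility_set (corona G H) X" "Inl v \<in> X" "Inr (v, x) \<in> X"
  shows "X \<subseteq> insert (Inl v) (Inr ` ({v} \<times> pverts H))"
proof
  fix z
  assume "z \<in> X"
  then have z: "z \<in> pverts (corona G H)"
    using assms(1) by (auto simp: mutual_visibility_set_def)
  show "z \<in> insert (Inl v) (Inr ` ({v} \<times> pverts H))"
  proof (rule ccontr)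
    assume notin: "\<not> ?thesis"
    then have out: "isl z \<or> corona_base z \<noteq> v"
      using z by (auto simp: verts_corona)
    then have "z \<noteq> Inr (v, x)"
      by auto
    then obtain p where "C.apath (Inr (v, x)) p z"
      and "set (pawalk_verts (Inr (v, x)) p) \<inter> X \<subseteq> {Inr (v, x), z}"
      using assms \<open>z \<in> X\<close>
      by (force simp: mutual_visibility_set_def visible_def shortest_path_def)
    then show False
      using awalk_leaving_copy_meets_root[OF C.awalkI_apath out] assms(2) notin by blast
  qed
qed

lemma card_mutual_visibility_set_le:
  assumes "mutual_visibility_set (corona G H) X"
    and "2 \<le> card (pverts G)" "pverts H \<noteq> {}"
  shows "card X \<le> card (pverts G) * card (pverts H)"
proof (cases "\<exists>v x. Inl v \<in> X \<and> Inr (v, x) \<in> X")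
  case True
  then obtain v x where "Inl v \<in> X" "Inr (v, x) \<in> X"
    by blast
  then have "X \<subseteq> insert (Inl v) (Inr ` ({v} \<times> pverts H))"
    by (rule mutual_visibility_set_root_and_copy[OF assms(1)])
  then have "card X \<le> card (insert (Inl v) (Inr ` ({v} \<times> pverts H)))"
    by (intro card_mono) (auto simp: H.pair_finite_verts)
  also have "\<dots> \<le> Suc (card (pverts H))"
    by (subst card_insert_disjoint)
       (auto simp: H.pair_finite_verts card_image card_cartesian_product)
  \<comment> \<open>A vertex of \<open>H\<close> absorbs the 1 that stands for the root.\<close>
  also have "\<dots> \<le> 2 * card (pverts H)"
    using assms(3) H.pair_finite_verts by (simp add: Suc_le_eq card_gt_0_iff)
  also have "\<dots> \<le> card (pverts G) * card (pverts H)"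
    using assms(2) by (rule mult_le_mono1)
  finally show ?thesis .
next
  case False
  obtain h where h: "h \<in> pverts H"
    using assms(3) by blast
  have X: "X \<subseteq> pverts (corona G H)"
    using assms(1) by (simp add: mutual_visibility_set_def)
  let ?f = "case_sum (\<lambda>v. (v, h)) id"
  \<comment> \<open>A collision would need \<open>Inl v\<close> and \<open>Inr (v, h)\<close> both
    in \<open>X\<close>, which this case excludes.\<close>
  have "inj_on ?f X"
    using False by (auto simp: inj_on_def split: sum.splits)
  moreover have "?f ` X \<subseteq> pverts G \<times> pverts H"
    using X h by (auto simp: verts_corona)
  ultimately have "card X \<le> card (pverts G \<times> pverts H)"
    by (intro card_inj_on_le) (simp_all add: G.pair_finite_verts H.pair_finite_verts)
  then show ?thesis
    by (simp add: card_cartesian_product)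
qed

end

theorem mainTheorem8:
  fixes G :: "'a pair_pre_digraph" and H :: "'b pair_pre_digraph"
  assumes "pair_graph G" and "Digraph_Component.connected (with_proj G)"
    and "2 \<le> card (pverts G)"
    and "pair_graph H" and "Digraph_Component.connected (with_proj H)"
    and "2 \<le> card (pverts H)"
  shows "mutual_visibility_number (corona G H) = card (pverts G) * card (pverts H)"
proof -
  interpret corona_graphs G H
    using assms(1,4) by (simp add: corona_graphs_def)
  have "pverts H \<noteq> {}"
    using assms(6) by auto
  then have "y \<le> card (pverts G) * card (pverts H)"
    if "y \<in> card ` {X. mutual_visibility_set (corona G H) X}" for y
    using that card_mutual_visibility_set_le assms(3) by auto
  moreover have "card (Inr ` (pverts G \<times> pverts H) :: ('a + 'a \<times> 'b) set)
      = card (pverts G) * card (pverts H)"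
    by (simp add: card_image card_cartesian_product)
  then have "card (pverts G) * card (pverts H)
      \<in> card ` {X. mutual_visibility_set (corona G H) X}"
    using mutual_visibility_set_copies[OF assms(2)] by (metis imageI mem_Collect_eq)
  ultimately show ?thesis
    unfolding mutual_visibility_number_def
    using finite_mutual_visibility_sets[OF C.pair_graph] by (intro Max_eqI) auto
qed

end
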